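(* (Hahn–Banach Theorem) Let $X$ be a linear $n$-normed space over the field $\mathbb{R}$, let $b_2,\dots,b_n\in X$ be fixed, and let $W$ be a subspace of $X$. Then each bounded $b$-linear functional $T_W$ defined on $W\times\langle b_2\rangle\times\cdots\times\langle b_n\rangle$ can be extended onto $X\times\langle b_2\rangle\times\cdots\times\langle b_n\rangle$ with preservation of the norm. In other words, there exists a bounded $b$-linear functional $T$ defined on $X\times\langle b_2\rangle\times\cdots\times\langle b_n\rangle$ such that $$T(x,b_2,\dots,b_n)=T_W(x,b_2,\dots,b_n)\ \text{ for all } x\in W\quad\text{and}\quad \|T_W\|=\|T\|.$$
   Context: $n\ge 2$ is an integer and all spaces are real. An $n$-norm on a real linear space $X$ is a function $\|\cdot,\dots,\cdot\|:X^n\to\mathbb{R}$ such that for all $x,y,x_1,\dots,x_n\in X$, $\alpha\in\mathbb{R}$: (I) $\|x_1,\dots,x_n\|=0$ if and only if $x_1,\dots,x_n$ are linearly dependent; (II) $\|x_1,\dots,x_n\|$ is invariant under permutations of $x_1,\dots,x_n$; (III) $\|\alpha x_1,x_2,\dots,x_n\|=|\alpha|\,\|x_1,x_2,\dots,x_n\|$; (IV) $\|x+y,x_2,\dots,x_n\|\le\|x,x_2,\dots,x_n\|+\|y,x_2,\dots,x_n\|$. A linear space with an $n$-norm is a linear $n$-normed space. $\langle b_i\rangle$ is the subspace of $X$ generated by $b_i$. For a subspace $W$ of $X$, a map $T:W\times\langle b_2\rangle\times\cdots\times\langle b_n\rangle\to\mathbb{R}$ is a $b$-linear functional if for all $x,y\in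 W$, $k\in\mathbb{R}$: $T(x+y,b_2,\dots,b_n)=T(x,b_2,\dots,b_n)+T(y,b_2,\dots,b_n)$ and $T(kx,b_2,\dots,b_n)=k\,T(x,b_2,\dots,b_n)$. It is bounded if there is a real $M>0$ with $|T(x,b_2,\dots,b_n)|\le M\|x,b_2,\dots,b_n\|$ for all $x\in W$; its norm $\|T\|$ is the infimum of all such $M>0$. *)

theory Defs
  imports "HOL-Analysis.Analysis"
begin

(* An n-tuple of vectors is a list of length n. Linear dependence is that of the
   tuple as an indexed family: a tuple with a repeated entry is dependent, whereas the
   library's "dependent" only sees the underlying set. *)
definition lin_dep_tuple :: "'a::real_vector list \<Rightarrow> bool" where
  "lin_dep_tuple xs \<longleftrightarrow>
     (\<exists>c :: nat \<Rightarrow> real. (\<exists>i<length xs. c i \<noteq> 0) \<and> (\<Sum>i<length xs. c i *\<^sub>R xs ! i) = 0)"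

lemma lin_dep_tuple_iff: "lin_dep_tuple xs \<longleftrightarrow> \<not> distinct xs \<or> dependent (set xs)"
proof (cases "distinct xs")
  case True
  then have bij: "bij_betw ((!) xs) {..<length xs} (set xs)"
    by (simp add: bij_betw_nth)
  have "lin_dep_tuple xs" if "dependent (set xs)"
  proof -
    obtain u v where u: "v \<in> set xs" "u v \<noteq> 0" "(\<Sum>v\<in>set xs. u v *\<^sub>R v) = 0"
      using \<open>dependent (set xs)\<close> dependent_finite[of "set xs"] by auto
    have "(\<Sum>i<length xs. u (xs ! i) *\<^sub>R xs ! i) = 0"
      using sum.reindex_bij_betw[OF bij, of "\<lambda>v. u v *\<^sub>R v"] u(3) by simp
    moreover have "\<exists>i<length xs. u (xs ! i) \<noteq> 0"
      using u by (metis in_set_conv_nth)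
    ultimately show ?thesis
      unfolding lin_dep_tuple_def by (intro exI[of _ "\<lambda>i. u (xs ! i)"]) simp
  qed
  moreover have "dependent (set xs)" if "lin_dep_tuple xs"
  proof -
    obtain c i where c: "i < length xs" "c i \<noteq> 0" "(\<Sum>i<length xs. c i *\<^sub>R xs ! i) = 0"
      using \<open>lin_dep_tuple xs\<close> by (auto simp: lin_dep_tuple_def)
    define u where "u = (\<lambda>v. c (the_inv_into {..<length xs} ((!) xs) v))"
    have u: "u (xs ! j) = c j" if "j < length xs" for j
      using that bij by (simp add: u_def the_inv_into_f_f bij_betw_def)
    have "(\<Sum>v\<in>set xs. u v *\<^sub>R v) = 0"
      using sum.reindex_bij_betw[OF bij, of "\<lambda>v. u v *\<^sub>R v", symmetric] c(3) u by simp
    moreover have "u (xs ! i) \<noteq> 0" "xs ! i \<in> set xs"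
      using u c by simp_all
    ultimately show ?thesis
      using dependent_finite[of "set xs"] by auto
  qed
  ultimately show ?thesis using True by blast
next
  case False
  then obtain i j where ij: "i < length xs" "j < length xs" "i \<noteq> j" "xs ! i = xs ! j"
    by (auto simp: distinct_conv_nth)
  define c :: "nat \<Rightarrow> real" where "c = (\<lambda>k. if k = i then 1 else if k = j then - 1 else 0)"
  have "(\<Sum>k<length xs. c k *\<^sub>R xs ! k) = (\<Sum>k\<in>{i,j}. c k *\<^sub>R xs ! k)"
    by (rule sum.mono_neutral_right) (use ij in \<open>auto simp: c_def\<close>)
  also have "\<dots> = 0" using ij by (simp add: c_def)
  finally have "lin_dep_tuple xs"
    unfolding lin_dep_tuple_def using ij(1) by (intro exI[of _ c]) (auto simp: c_def)
  then show ?thesis using False by simp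
qed

(* Only the values of the n-norm on lists of length n matter. *)
locale linear_n_normed_space =
  fixes n :: nat and N :: "'a::real_vector list \<Rightarrow> real"
  assumes n_ge_2: "n \<ge> 2"
    and zero_iff: "\<And>xs. length xs = n \<Longrightarrow> N xs = 0 \<longleftrightarrow> lin_dep_tuple xs"
    and perm: "\<And>xs ys. length xs = n \<Longrightarrow> mset xs = mset ys \<Longrightarrow> N xs = N ys"
    and scale: "\<And>\<alpha> x xs. length (x # xs) = n \<Longrightarrow> N ((\<alpha> *\<^sub>R x) # xs) = \<bar>\<alpha>\<bar> * N (x # xs)"
    and triangle: "\<And>x y xs. length (x # xs) = n \<Longrightarrow> N ((x + y) # xs) \<le> N (x # xs) + N (y # xs)"

(* Throughout, bs is the list [b_2, ..., b_n]. *)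
definition b_domain :: "'a::real_vector set \<Rightarrow> 'a list \<Rightarrow> 'a list set" where
  "b_domain W bs = listset (W # map (\<lambda>b. span {b}) bs)"

(* A map on W x <b_2> x ... x <b_n> is represented by its extensional version
   (equal to undefined off the domain). Linearity is only required in the first
   argument, with the others fixed at b_2, ..., b_n. *)
definition b_linear_functional :: "'a::real_vector set \<Rightarrow> 'a list \<Rightarrow> ('a list \<Rightarrow> real) \<Rightarrow> bool" where
  "b_linear_functional W bs T \<longleftrightarrow>
     T \<in> b_domain W bs \<rightarrow>\<^sub>E UNIV \<and>
     (\<forall>x\<in>W. \<forall>y\<in>W. T ((x + y) # bs) = T (x # bs) + T (y # bs)) \<and>
     (\<forall>x\<in>W. \<forall>k. T ((k *\<^sub>R x) # bs) = k * T (x # bs))"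

definition b_bounds ::
  "('a::real_vector list \<Rightarrow> real) \<Rightarrow> 'a set \<Rightarrow> 'a list \<Rightarrow> ('a list \<Rightarrow> real) \<Rightarrow> real set" where
  "b_bounds N W bs T = {M. M > 0 \<and> (\<forall>x\<in>W. \<bar>T (x # bs)\<bar> \<le> M * N (x # bs))}"

definition b_bounded ::
  "('a::real_vector list \<Rightarrow> real) \<Rightarrow> 'a set \<Rightarrow> 'a list \<Rightarrow> ('a list \<Rightarrow> real) \<Rightarrow> bool" where
  "b_bounded N W bs T \<longleftrightarrow> b_bounds N W bs T \<noteq> {}"

definition b_norm ::
  "('a::real_vector list \<Rightarrow> real) \<Rightarrow> 'a set \<Rightarrow> 'a list \<Rightarrow> ('a list \<Rightarrow> real) \<Rightarrow> real" where
  "b_norm N W bs T = Inf (b_bounds N W bs T)"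

end

theory Submission
  imports Defs
begin

text \<open>
  With \<open>bs\<close> fixed, \<open>p x = N (x # bs)\<close> is a seminorm on the whole space, so the assertion is the
  Hahn--Banach theorem for a seminorm. It is not a norm: \<open>p\<close> vanishes on the span of \<open>bs\<close>, and
  everywhere if \<open>bs\<close> is linearly dependent.

  Partial linear functionals below a sublinear \<open>p\<close> are encoded by their graphs, that is by linear
  subspaces \<open>G\<close> of the product with the reals such that \<open>a \<le> p x\<close> for \<open>(x, a) \<in> G\<close>. Such a
  subspace is automatically single-valued (\<open>dominated_graph_single_valued\<close>), so extension of
  functionals is inclusion of subspaces and the upper bound in Zorn's lemma is a union. A maximal
  graph is total, since it can be extended by any vector \<open>x0\<close>: subadditivity of \<open>p\<close> leaves room
  for a value at \<open>x0\<close> (\<open>dominated_graph_extend\<close>).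

  The norm is preserved in a strong form: the infimum \<open>m\<close> of the bounds of \<open>T\<^sub>W\<close> is itself a
  bound in the weak sense \<open>\<bar>T\<^sub>W (x # bs)\<bar> \<le> m * p x\<close> (although \<open>m\<close> may be zero), so an extension
  dominated by the seminorm \<open>m * p\<close> has exactly the same set of bounds as \<open>T\<^sub>W\<close>.
\<close>

section \<open>Hahn--Banach extension for sublinear functionals\<close>

definition sublinear :: "('a::real_vector \<Rightarrow> real) \<Rightarrow> bool" where
  "sublinear p \<longleftrightarrow> (\<forall>x y. p (x + y) \<le> p x + p y) \<and> (\<forall>x. \<forall>t\<ge>0. p (t *\<^sub>R x) = t * p x)"

definition dominated_graph :: "('a::real_vector \<Rightarrow> real) \<Rightarrow> ('a \<times> real) set \<Rightarrow> bool" where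
  "dominated_graph p G \<longleftrightarrow> subspace G \<and> (\<forall>(x, a)\<in>G. a \<le> p x)"

lemma sublinear_0: "sublinear p \<Longrightarrow> p 0 = 0"
  unfolding sublinear_def by (metis mult_zero_left order_refl scale_zero_left)

text \<open>The difference of two values at \<open>x\<close>, in either order, is a value at zero and hence
  at most \<open>p 0 = 0\<close>.\<close>

lemma dominated_graph_single_valued:
  assumes p: "sublinear p" and G: "dominated_graph p G" and "(x, a) \<in> G" "(x, b) \<in> G"
  shows "a = b"
proof -
  have "(x, a) - (x, b) \<in> G" "(x, b) - (x, a) \<in> G"
    using assms by (auto simp: dominated_graph_def intro!: subspace_diff simp del: diff_Pair)
  then have "a - b \<le> p 0" "b - a \<le> p 0"
    using G by (auto simp: dominated_graph_def)
  then show ?thesis using sublinear_0[OF p] by simp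
qed

text \<open>The value \<open>c\<close> at \<open>x0\<close> must satisfy \<open>a - p (y - x0) \<le> c \<le> p (z + x0) - b\<close> for all
  \<open>(y, a), (z, b) \<in> G\<close>. Every lower bound is below every upper bound because
  \<open>a + b \<le> p (y + z) \<le> p (y - x0) + p (z + x0)\<close>; so the supremum of the lower bounds will do.
  Positive homogeneity reduces all other multiples of \<open>x0\<close> to \<open>x0\<close> and \<open>- x0\<close>.\<close>

lemma dominated_graph_extend:
  assumes p: "sublinear p" and G: "dominated_graph p G"
  obtains c where "dominated_graph p (span (insert (x0, c) G))"
proof -
  have sub: "subspace G" and dom: "\<And>x a. (x, a) \<in> G \<Longrightarrow> a \<le> p x"
    using G by (auto simp: dominated_graph_def)
  have tri: "p (x + y) \<le> p x + p y" for x y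
    using p by (simp add: sublinear_def)
  have hom: "p (t *\<^sub>R x) = t * p x" if "t \<ge> 0" for t x
    using p that by (simp add: sublinear_def)
  define L where "L = (\<lambda>(y, a). a - p (y - x0)) ` G"
  have L_ne: "L \<noteq> {}"
    using subspace_0[OF sub] by (auto simp: L_def)
  have L_le: "l \<le> p (z + x0) - b" if "l \<in> L" "(z, b) \<in> G" for l z b
  proof -
    obtain y a where y: "(y, a) \<in> G" "l = a - p (y - x0)"
      using \<open>l \<in> L\<close> by (auto simp: L_def)
    have "a + b \<le> p (y + z)"
      using dom subspace_add[OF sub y(1) that(2)] by simp
    also have "\<dots> \<le> p (y - x0) + p (z + x0)"
      using tri[of "y - x0" "z + x0"] by simp
    finally show ?thesis using y(2) by simp
  qed
  define c where "c = Sup L"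
  have bdd: "bdd_above L"
    using L_le subspace_0[OF sub] unfolding zero_prod_def bdd_above_def by blast
  have lower: "a - c \<le> p (y - x0)" if "(y, a) \<in> G" for y a
  proof -
    have "a - p (y - x0) \<le> c"
      unfolding c_def by (rule cSup_upper[OF _ bdd]) (use that in \<open>force simp: L_def\<close>)
    then show ?thesis by simp
  qed
  have upper: "b + c \<le> p (z + x0)" if "(z, b) \<in> G" for z b
    using cSup_least[OF L_ne, of "p (z + x0) - b"] L_le[OF _ that] by (simp add: c_def)
  have below: "v \<le> p u" if uv: "(u, v) \<in> span (insert (x0, c) G)" for u v
  proof -
    obtain t where "(u, v) - t *\<^sub>R (x0, c) \<in> span G"
      using uv unfolding span_breakdown_eq by blast
    then have t: "(u - t *\<^sub>R x0, v - t * c) \<in> G"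
      using span_minimal[OF order_refl sub] by (simp add: subset_iff)
    consider "t = 0" | "t > 0" | "t < 0" by linarith
    then show ?thesis
    proof cases
      case 1
      then show ?thesis using dom t by simp
    next
      case 2
      have "inverse t *\<^sub>R (u - t *\<^sub>R x0, v - t * c) \<in> G"
        using subspace_scale[OF sub t] .
      then have "(inverse t *\<^sub>R u - x0, inverse t * v - c) \<in> G"
        using 2 by (simp add: algebra_simps)
      from upper[OF this] have "inverse t * v \<le> inverse t * p u"
        using 2 hom[of "inverse t" u] by simp
      then show ?thesis using 2 by simp
    next
      case 3
      define s where "s = - t"
      have s: "s > 0" "t = - s" using 3 by (auto simp: s_def)
      have "inverse s *\<^sub>R (u - t *\<^sub>R x0, v - t * c) \<in> G"
        using subspace_scale[OF sub t] .
      then have "(inverse s *\<^sub>R u + x0, inverse s * v + c) \<in> G"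
        using s by (simp add: algebra_simps)
      from lower[OF this] have "inverse s * v \<le> inverse s * p u"
        using s hom[of "inverse s" u] by simp
      then show ?thesis using s by simp
    qed
  qed
  show thesis
    by (rule that[of c]) (use below in \<open>auto simp: dominated_graph_def\<close>)
qed

lemma subspace_Union_chain:
  assumes "\<C> \<noteq> {}" and "\<And>G. G \<in> \<C> \<Longrightarrow> subspace G"
    and chain: "\<And>G H. G \<in> \<C> \<Longrightarrow> H \<in> \<C> \<Longrightarrow> G \<subseteq> H \<or> H \<subseteq> G"
  shows "subspace (\<Union>\<C>)"
proof (rule subspaceI)
  show "0 \<in> \<Union>\<C>" using assms(1,2) subspace_0 by blast
next
  fix x y assume "x \<in> \<Union>\<C>" "y \<in> \<Union>\<C>"
  then obtain G H where GH: "G \<in> \<C>" "H \<in> \<C>" "x \<in> G" "y \<in> H" by blast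
  then show "x + y \<in> \<Union>\<C>"
    using chain[OF GH(1,2)] assms(2) by (meson UnionI subsetD subspace_add)
next
  fix t x assume "x \<in> \<Union>\<C>"
  then show "t *\<^sub>R x \<in> \<Union>\<C>" using assms(2) subspace_scale by blast
qed

lemma dominated_graph_total_extension:
  assumes p: "sublinear p" and G0: "dominated_graph p G0"
  obtains G where "dominated_graph p G" "G0 \<subseteq> G" "\<And>x. \<exists>a. (x, a) \<in> G"
proof -
  define \<A> where "\<A> = {G. dominated_graph p G \<and> G0 \<subseteq> G}"
  have "\<Union>\<C> \<in> \<A>" if "\<C> \<noteq> {}" "subset.chain \<A> \<C>" for \<C>
  proof -
    have \<C>: "\<C> \<subseteq> \<A>" "\<And>G H. G \<in> \<C> \<Longrightarrow> H \<in> \<C> \<Longrightarrow> G \<subseteq> H \<or> H \<subseteq> G"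
      using that(2) by (auto simp: subset_chain_def)
    have "subspace (\<Union>\<C>)"
      using \<C> that(1) by (intro subspace_Union_chain) (auto simp: \<A>_def dominated_graph_def)
    moreover have "G0 \<subseteq> \<Union>\<C>"
      using \<C>(1) that(1) by (auto simp: \<A>_def)
    ultimately show ?thesis
      using \<C>(1) by (fastforce simp: \<A>_def dominated_graph_def)
  qed
  moreover have "\<A> \<noteq> {}" using G0 by (auto simp: \<A>_def)
  ultimately obtain G where G: "G \<in> \<A>" and max: "\<And>H. H \<in> \<A> \<Longrightarrow> G \<subseteq> H \<Longrightarrow> H = G"
    using subset_Zorn_nonempty[of \<A>] by blast
  have "\<exists>a. (x, a) \<in> G" for x
  proof -
    obtain c where c: "dominated_graph p (span (insert (x, c) G))"
      using dominated_graph_extend[OF p] G by (auto simp: \<A>_def)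
    have "insert (x, c) G \<subseteq> span (insert (x, c) G)" by (rule span_superset)
    moreover from this have "span (insert (x, c) G) = G"
      using max c G by (auto simp: \<A>_def)
    ultimately show ?thesis by auto
  qed
  then show thesis using that G by (auto simp: \<A>_def)
qed

theorem Hahn_Banach_sublinear:
  fixes p f :: "'a::real_vector \<Rightarrow> real"
  assumes p: "sublinear p" and W: "subspace W"
    and add: "\<And>x y. x \<in> W \<Longrightarrow> y \<in> W \<Longrightarrow> f (x + y) = f x + f y"
    and scale: "\<And>k x. x \<in> W \<Longrightarrow> f (k *\<^sub>R x) = k * f x"
    and le: "\<And>x. x \<in> W \<Longrightarrow> f x \<le> p x"
  obtains g where "linear g" "\<And>x. x \<in> W \<Longrightarrow> g x = f x" "\<And>x. g x \<le> p x"
proof -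
  define G0 where "G0 = (\<lambda>x. (x, f x)) ` W"
  have "f 0 = 0"
    using scale[of 0 0] subspace_0[OF W] by simp
  then have "subspace G0"
    unfolding G0_def using W
    by (intro subspaceI) (force simp: zero_prod_def subspace_def add scale)+
  then have "dominated_graph p G0"
    using le by (auto simp: dominated_graph_def G0_def)
  then obtain G where G: "dominated_graph p G" "G0 \<subseteq> G" and total: "\<And>x. \<exists>a. (x, a) \<in> G"
    using dominated_graph_total_extension[OF p] by blast
  have sub: "subspace G" using G by (simp add: dominated_graph_def)
  obtain g where g: "\<And>x. (x, g x) \<in> G" using total by metis
  have eq: "g x = a" if "(x, a) \<in> G" for x a
    using dominated_graph_single_valued[OF p G(1) g that] .
  show thesis
  proof (rule that[of g])
    show "linear g"
    proof (rule linearI)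
      show "g (x + y) = g x + g y" for x y
        using subspace_add[OF sub g[of x] g[of y]] by (auto intro: eq)
      show "g (k *\<^sub>R x) = k *\<^sub>R g x" for k x
        using subspace_scale[OF sub g[of x], of k] by (auto intro: eq)
    qed
    show "g x = f x" if "x \<in> W" for x
      using that G(2) by (auto intro!: eq simp: G0_def)
    show "g x \<le> p x" for x
      using g[of x] G(1) by (auto simp: dominated_graph_def)
  qed
qed

section \<open>The seminorm obtained by fixing all but one argument of an n-norm\<close>

context linear_n_normed_space
begin

lemma N_zero:
  assumes "length (x # xs) = n"
  shows "N (0 # xs) = 0"
  using scale[of x xs 0] assms by simp

text \<open>Nonnegativity follows from the axioms: \<open>0 = N (x - x, \<dots>) \<le> 2 N (x, \<dots>)\<close>.\<close>

lemma N_nonneg: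
  assumes "length (x # xs) = n"
  shows "0 \<le> N (x # xs)"
  using triangle[of x xs "- x"] scale[of x xs "- 1"] N_zero[of x xs] assms by simp

lemma sublinear_N:
  assumes "length bs = n - 1" and "0 \<le> m"
  shows "sublinear (\<lambda>x. m * N (x # bs))"
proof -
  have len: "length (x # bs) = n" for x using assms n_ge_2 by simp
  have "m * N ((x + y) # bs) \<le> m * N (x # bs) + m * N (y # bs)" for x y
    using mult_left_mono[OF triangle[OF len] assms(2)] by (simp add: distrib_left)
  moreover have "m * N ((t *\<^sub>R x) # bs) = t * (m * N (x # bs))" if "t \<ge> 0" for t x
    using scale[OF len] that by simp
  ultimately show ?thesis by (simp add: sublinear_def)
qed

end

section \<open>Extension of bounded b-linear functionals\<close>

lemma Cons_in_b_domain: "x \<in> W \<Longrightarrow> x # bs \<in> b_domain W bs"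
proof -
  have "bs \<in> listset (map (\<lambda>b. span {b}) bs)"
    by (induction bs) (auto simp: set_Cons_def span_base)
  then show "x \<in> W \<Longrightarrow> x # bs \<in> b_domain W bs"
    by (simp add: b_domain_def set_Cons_def)
qed

lemma bdd_below_b_bounds: "bdd_below (b_bounds N W bs T)"
  by (rule bdd_belowI[of _ 0]) (auto simp: b_bounds_def)

lemma b_norm_le: "M \<in> b_bounds N W bs T \<Longrightarrow> b_norm N W bs T \<le> M"
  unfolding b_norm_def by (rule cInf_lower[OF _ bdd_below_b_bounds])

lemma b_norm_nonneg: "b_bounded N W bs T \<Longrightarrow> 0 \<le> b_norm N W bs T"
  unfolding b_norm_def b_bounded_def by (rule cInf_greatest) (auto simp: b_bounds_def)

text \<open>Where \<open>N (x # bs)\<close> is positive, one divides by it; where it vanishes, any bound forces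
  the functional to vanish.\<close>

lemma abs_le_b_norm:
  assumes "b_bounded N W bs T" "x \<in> W" "0 \<le> N (x # bs)"
  shows "\<bar>T (x # bs)\<bar> \<le> b_norm N W bs T * N (x # bs)"
proof (cases "N (x # bs) = 0")
  case True
  then show ?thesis using assms(1,2) by (auto simp: b_bounded_def b_bounds_def)
next
  case False
  then have pos: "N (x # bs) > 0" using assms(3) by simp
  have "\<bar>T (x # bs)\<bar> / N (x # bs) \<le> b_norm N W bs T"
    unfolding b_norm_def
    using assms(1,2) pos by (intro cInf_greatest) (auto simp: b_bounded_def b_bounds_def field_simps)
  then show ?thesis using pos by (simp add: field_simps)
qed

theorem theorem5p9:
  fixes n :: nat
    and N :: "'a::real_vector list \<Rightarrow> real"
    and bs :: "'a list"
    and W :: "'a set"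
    and T\<^sub>W :: "'a list \<Rightarrow> real"
  assumes "linear_n_normed_space n N"
    and "length bs = n - 1"
    and "subspace W"
    and "b_linear_functional W bs T\<^sub>W"
    and "b_bounded N W bs T\<^sub>W"
  shows "\<exists>T. b_linear_functional UNIV bs T \<and> b_bounded N UNIV bs T \<and>
           (\<forall>x\<in>W. T (x # bs) = T\<^sub>W (x # bs)) \<and>
           b_norm N W bs T\<^sub>W = b_norm N UNIV bs T"
proof -
  interpret linear_n_normed_space n N by fact
  have len: "length (x # bs) = n" for x using assms(2) n_ge_2 by simp
  note nonneg = N_nonneg[OF len]
  define m where "m = b_norm N W bs T\<^sub>W"
  define p where "p = (\<lambda>x. m * N (x # bs))"
  have p: "sublinear p"
    unfolding p_def m_def by (rule sublinear_N[OF assms(2) b_norm_nonneg[OF assms(5)]])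
  have "T\<^sub>W (x # bs) \<le> p x" if "x \<in> W" for x
    using abs_le_b_norm[of N W bs T\<^sub>W x, OF assms(5) that nonneg] by (simp add: p_def m_def)
  then obtain g where g: "linear g" "\<And>x. x \<in> W \<Longrightarrow> g x = T\<^sub>W (x # bs)" "\<And>x. g x \<le> p x"
    using Hahn_Banach_sublinear[OF p assms(3), of "\<lambda>x. T\<^sub>W (x # bs)"] assms(4)
    unfolding b_linear_functional_def by blast
  have "p (- x) = p x" for x
    using scale[OF len, of "- 1" x] by (simp add: p_def)
  then have abs_g: "\<bar>g x\<bar> \<le> p x" for x
    using g(3)[of x] g(3)[of "- x"] linear_neg[OF g(1), of x] by simp
  define T where "T = restrict (\<lambda>xs. g (hd xs)) (b_domain UNIV bs)"
  have T: "T (x # bs) = g x" for x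
    by (simp add: T_def Cons_in_b_domain)
  have "T \<in> b_domain UNIV bs \<rightarrow>\<^sub>E UNIV"
    by (simp add: T_def)
  then have lin: "b_linear_functional UNIV bs T"
    using g(1) by (simp add: b_linear_functional_def T linear_add linear_scale)
  have "b_bounds N W bs T\<^sub>W \<subseteq> b_bounds N UNIV bs T"
  proof
    fix M assume M: "M \<in> b_bounds N W bs T\<^sub>W"
    then have "m \<le> M" by (simp add: m_def b_norm_le)
    then have "p x \<le> M * N (x # bs)" for x
      unfolding p_def by (rule mult_right_mono[OF _ nonneg])
    then show "M \<in> b_bounds N UNIV bs T"
      using M abs_g order_trans by (fastforce simp: b_bounds_def T)
  qed
  moreover have "b_bounds N UNIV bs T \<subseteq> b_bounds N W bs T\<^sub>W"
    by (auto simp: b_bounds_def T g(2)[symmetric])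
  ultimately have "b_bounds N W bs T\<^sub>W = b_bounds N UNIV bs T" by blast
  then have "b_bounded N UNIV bs T" "b_norm N W bs T\<^sub>W = b_norm N UNIV bs T"
    using assms(5) by (simp_all add: b_bounded_def b_norm_def)
  then show ?thesis
    using lin T g(2) by auto
qed

end
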